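(* Let $\mathcal{M}$ be the set of all left-stochastic $(m+1)\times(m+1)$ matrices, let $\Lambda:=\Delta^{m+1}$ be the $(m+1)$-dimensional simplex, and assume that each $\tilde g_i$ upper bounds the corresponding $g_i$, for $i\in\{1,\dots,m\}$. Let $\theta^{(1)},\dots,\theta^{(T)}\in\Theta$ and $\lambda^{(1)},\dots,\lambda^{(T)}\in\Lambda$ be sequences satisfying $$\frac1T\sum_{t=1}^T\mathcal{L}_\theta(\theta^{(t)},\lambda^{(t)})-\inf_{\theta^*\in\Theta}\frac1T\sum_{t=1}^T\mathcal{L}_\theta(\theta^*,\lambda^{(t)})\le\epsilon_\theta,$$ $$\max_{M^*\in\mathcal{M}}\frac1T\sum_{t=1}^T\mathcal{L}_\lambda(\theta^{(t)},M^*\lambda^{(t)})-\frac1T\sum_{t=1}^T\mathcal{L}_\lambda(\theta^{(t)},\lambda^{(t)})\le\epsilon_\lambda .$$ Define $\bar\theta$ as a random variable for which $\bar\theta=\theta^{(t)}$ with probability $\lambda^{(t)}_1/\sum_{s=1}^T\lambda^{(s)}_1$, and let $\bar\lambda:=\frac1T\sum_{t=1}^T\lambda^{(t)}$, with first coordinate $\bar\lambda_1$. Then $\bar\theta$ is nearly-optimal in expectation: $$\mathbb{E}_{\bar\theta}[g_0(\bar\theta)]\le\inf_{\theta^*\in\Theta:\ \forall i,\ \tilde g_i(\theta^* )\le0}g_0(\theta^* )+\frac{\epsilon_\theta+\epsilon_\lambda}{\bar\lambda_1},$$ and nearly-feasible: $$\max_{i\in\{1,\dots,m\}}\mathbb{E}_{\bar\theta}[g_i(\bar\theta)]\le\frac{\epsilon_\lambda}{\bar\lambda_1}.$$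 Additionally, if there exists a $\theta'\in\Theta$ that satisfies all of the proxy constraints with margin $\gamma$ (i.e. $\tilde g_i(\theta')\le-\gamma$ for all $i\in\{1,\dots,m\}$), then $$\bar\lambda_1\ge\frac{\gamma-\epsilon_\theta-\epsilon_\lambda}{\gamma+B_{g_0}},$$ where $B_{g_0}\ge\sup_{\theta\in\Theta}g_0(\theta)-\inf_{\theta\in\Theta}g_0(\theta)$ is a bound on the range of the objective function $g_0$.
   Context: $\Theta$ is a set of parameters; $g_0,g_1,\dots,g_m:\Theta\to\mathbb{R}$ are the objective and constraint functions and $\tilde g_1,\dots,\tilde g_m:\Theta\to\mathbb{R}$ are the proxy constraint functions. $\Delta^{m+1}:=\{\lambda\in\mathbb{R}_+^{m+1}:\sum_{j=1}^{m+1}\lambda_j=1\}$. A matrix $M\in\mathbb{R}^{(m+1)\times(m+1)}$ is left-stochastic if each of its columns lies in $\Delta^{m+1}$. The proxy-Lagrangians $\mathcal{L}_\theta,\mathcal{L}_\lambda:\Theta\times\Delta^{m+1}\to\mathbb{R}$ are $$\mathcal{L}_\theta(\theta,\lambda):=\lambda_1g_0(\theta)+\sum_{i=1}^m\lambda_{i+1}\tilde g_i(\theta),\qquad\mathcal{L}_\lambda(\theta,\lambda):=\sum_{i=1}^m\lambda_{i+1}g_i(\theta).$$ *)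

theory Defs
  imports
    "HOL-Probability.Probability_Mass_Function"
    "HOL-Library.Extended_Real"
    "Jordan_Normal_Form.Matrix"
begin

unbundle no vec_syntax

text \<open>Vectors and matrices are indexed from 0: the multiplier \<open>\<lambda>\<^sub>1\<close> of the objective is
  entry 0, and the multiplier \<open>\<lambda>\<^sub>i\<^sub>+\<^sub>1\<close> of the \<open>i\<close>-th constraint is entry \<open>i\<close>.\<close>

definition prob_simplex :: "nat \<Rightarrow> real vec set" where
  "prob_simplex n = {l \<in> carrier_vec n. (\<forall>j<n. 0 \<le> l $ j) \<and> (\<Sum>j<n. l $ j) = 1}"

definition left_stochastic :: "nat \<Rightarrow> real mat set" where
  "left_stochastic n = {M \<in> carrier_mat n n. \<forall>j<n. col M j \<in> prob_simplex n}"

definition L_theta :: "nat \<Rightarrow> ('a \<Rightarrow> real) \<Rightarrow> (nat \<Rightarrow> 'a \<Rightarrow> real) \<Rightarrow> 'a \<Rightarrow> real vec \<Rightarrow> real" where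
  "L_theta m g0 gt \<theta> l = l $ 0 * g0 \<theta> + (\<Sum>i=1..m. l $ i * gt i \<theta>)"

definition L_lambda :: "nat \<Rightarrow> (nat \<Rightarrow> 'a \<Rightarrow> real) \<Rightarrow> 'a \<Rightarrow> real vec \<Rightarrow> real" where
  "L_lambda m g \<theta> l = (\<Sum>i=1..m. l $ i * g i \<theta>)"

definition mean_vec :: "nat \<Rightarrow> nat \<Rightarrow> (nat \<Rightarrow> real vec) \<Rightarrow> real vec" where
  "mean_vec n T l = vec n (\<lambda>j. (\<Sum>t=1..T. l t $ j) / real T)"

text \<open>The law of the random iterate. The weights form a probability distribution as soon as
  \<open>l t $ 0 > 0\<close> for some \<open>t\<close>; repeated iterates have their weights added up.\<close>

definition theta_bar :: "nat \<Rightarrow> (nat \<Rightarrow> 'a) \<Rightarrow> (nat \<Rightarrow> real vec) \<Rightarrow> 'a pmf" where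
  "theta_bar T \<theta> l =
     pmf_of_list (map (\<lambda>t. (\<theta> t, l t $ 0 / (\<Sum>s=1..T. l s $ 0))) [1..<Suc T])"

lemma pmf_theta_bar:
  assumes simplex: "\<And>t. t \<in> {1..T} \<Longrightarrow> l t \<in> prob_simplex (Suc m)"
    and pos: "mean_vec (Suc m) T l $ 0 > 0"
  shows "pmf (theta_bar T \<theta> l) x =
           (\<Sum>t | t \<in> {1..T} \<and> \<theta> t = x. l t $ 0 / (\<Sum>s=1..T. l s $ 0))"
proof -
  let ?S = "\<Sum>s=1..T. l s $ 0"
  let ?w = "\<lambda>t. l t $ 0 / ?S"
  let ?xs = "map (\<lambda>t. (\<theta> t, ?w t)) [1..<Suc T]"
  have S: "?S > 0"
    using pos by (simp add: mean_vec_def zero_less_divide_iff)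
  have nonneg: "0 \<le> l t $ 0" if "t \<in> {1..T}" for t
    using simplex[OF that] by (simp add: prob_simplex_def)
  have sum_eq: "sum_list (map ?w ts) = sum ?w (set ts)" if "distinct ts" for ts
    using that by (simp add: sum_list_distinct_conv_sum_set)
  have set_eq: "set [1..<Suc T] = {1..T}"
    by auto
  have "sum_list (map snd ?xs) = sum_list (map ?w [1..<Suc T])"
    by (simp add: o_def del: upt_Suc)
  also have "\<dots> = sum ?w {1..T}"
    by (simp only: sum_eq[OF distinct_upt] set_eq)
  also have "\<dots> = 1"
    using S by (simp add: sum_divide_distrib[symmetric])
  finally have wf: "pmf_of_list_wf ?xs"
    using nonneg S unfolding pmf_of_list_wf_def
    by (auto simp: set_eq simp del: upt_Suc)
  have "pmf (theta_bar T \<theta> l) x = sum_list (map snd (filter (\<lambda>z. fst z = x) ?xs))"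
    unfolding theta_bar_def by (rule pmf_pmf_of_list[OF wf])
  also have "\<dots> = sum_list (map ?w (filter (\<lambda>t. \<theta> t = x) [1..<Suc T]))"
    by (simp add: filter_map o_def del: upt_Suc)
  also have "\<dots> = sum ?w (set (filter (\<lambda>t. \<theta> t = x) [1..<Suc T]))"
    by (rule sum_eq) simp
  also have "set (filter (\<lambda>t. \<theta> t = x) [1..<Suc T]) = {t. t \<in> {1..T} \<and> \<theta> t = x}"
    by auto
  finally show ?thesis .
qed

end

theory Submission
  imports Defs
begin

text \<open>The \<open>\<lambda>\<close>-player is compared with two reallocations of mass. Moving everything to the objective
  makes its payoff vanish, so its average payoff is at least \<open>-eps_lambda\<close>; since the proxies dominate
  the constraints, this bounds the average proxy payoff from below, and the regret of the
  \<open>\<theta>\<close>-player against a feasible (or strictly feasible) point yields optimality (or the bound on the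
  mean multiplier). Moving the mass of the objective to the \<open>i\<close>-th constraint yields near-feasibility.\<close>

text \<open>The law adds up the weights of rounds that share an iterate, so grouping the rounds by
  the value of \<open>\<theta>\<close> turns the sum over distinct points into a sum over
  rounds.\<close>

lemma expectation_theta_bar:
  assumes simplex: "\<And>t. t \<in> {1..T} \<Longrightarrow> l t \<in> prob_simplex (Suc m)"
    and pos: "mean_vec (Suc m) T l $ 0 > 0"
  shows "measure_pmf.expectation (theta_bar T \<theta> l) f =
           (\<Sum>t=1..T. l t $ 0 * f (\<theta> t)) / (\<Sum>t=1..T. l t $ 0)"
proof -
  define S where "S = (\<Sum>t=1..T. l t $ 0)"
  have pmf_eq: "pmf (theta_bar T \<theta> l) x = (\<Sum>t | t \<in> {1..T} \<and> \<theta> t = x. l t $ 0 / S)" for x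
    unfolding S_def by (rule pmf_theta_bar[OF simplex pos])
  \<comment> \<open>An iterate whose total weight is zero lies outside the support, so this is only
    an inclusion; it suffices to write the integral as a finite sum.\<close>
  have supp: "x \<in> \<theta> ` {1..T}" if "x \<in> set_pmf (theta_bar T \<theta> l)" for x
  proof (rule ccontr)
    assume "x \<notin> \<theta> ` {1..T}"
    then have none: "{t. t \<in> {1..T} \<and> \<theta> t = x} = {}" by blast
    have "pmf (theta_bar T \<theta> l) x = 0" unfolding pmf_eq none by simp
    with that show False by (simp add: set_pmf_iff)
  qed
  have "measure_pmf.expectation (theta_bar T \<theta> l) f
      = (\<Sum>x\<in>\<theta> ` {1..T}. pmf (theta_bar T \<theta> l) x * f x)"
    by (subst integral_measure_pmf[of "\<theta> ` {1..T}"]) (use supp in auto)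
  also have "\<dots> = (\<Sum>x\<in>\<theta> ` {1..T}. \<Sum>t | t \<in> {1..T} \<and> \<theta> t = x. l t $ 0 / S * f (\<theta> t))"
    unfolding pmf_eq sum_distrib_right by (intro sum.cong refl) auto
  also have "\<dots> = (\<Sum>t=1..T. l t $ 0 / S * f (\<theta> t))"
    by (rule sum.group) auto
  finally show ?thesis
    by (simp add: S_def sum_divide_distrib)
qed

text \<open>Column \<open>j\<close> is the unit vector at \<open>f j\<close>, so multiplication
  sends all the mass of entry \<open>j\<close> to entry \<open>f j\<close>.\<close>

definition reallocation :: "nat \<Rightarrow> (nat \<Rightarrow> nat) \<Rightarrow> real mat" where
  "reallocation n f = mat n n (\<lambda>(i, j). if i = f j then 1 else 0)"

lemma reallocation_left_stochastic:
  assumes "\<And>j. j < n \<Longrightarrow> f j < n"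
  shows "reallocation n f \<in> left_stochastic n"
  using assms
  by (auto simp: left_stochastic_def prob_simplex_def reallocation_def)

lemma reallocation_mult_vec:
  assumes "v \<in> carrier_vec n" "i < n"
  shows "(reallocation n f *\<^sub>v v) $ i = (\<Sum>j<n. if f j = i then v $ j else 0)"
  using assms
  by (auto simp: reallocation_def scalar_prod_def lessThan_atLeast0 intro!: sum.cong)

text \<open>All mass lands on entry 0, which does not occur in \<open>L_lambda\<close>.\<close>

lemma L_lambda_reallocation_to_objective:
  assumes "v \<in> carrier_vec (Suc m)"
  shows "L_lambda m g x (reallocation (Suc m) (\<lambda>_. 0) *\<^sub>v v) = 0"
  unfolding L_lambda_def
  by (rule sum.neutral) (use assms in \<open>auto simp: reallocation_mult_vec\<close>)

text \<open>The map \<open>id(0 := i)\<close> moves only entry 0. Summed over the rounds, the gain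
  is the unnormalised expectation of \<open>g i\<close> under \<open>theta_bar\<close>.\<close>

lemma L_lambda_reallocation_to_constraint:
  assumes v: "v \<in> carrier_vec (Suc m)" and i: "i \<in> {1..m}"
  shows "L_lambda m g x (reallocation (Suc m) (id(0 := i)) *\<^sub>v v)
           = L_lambda m g x v + v $ 0 * g i x"
proof -
  have entry: "(reallocation (Suc m) (id(0 := i)) *\<^sub>v v) $ k
      = v $ k + (if k = i then v $ 0 else 0)" if k: "k \<in> {1..m}" for k
  proof -
    have "(reallocation (Suc m) (id(0 := i)) *\<^sub>v v) $ k
        = (\<Sum>j<Suc m. if (id(0 := i)) j = k then v $ j else 0)"
      using v k by (simp add: reallocation_mult_vec)
    \<comment> \<open>As \<open>k\<close> is nonzero, the cases \<open>j = k\<close> and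
      \<open>j = 0\<close> exclude each other, so the summand splits into two delta
      functions.\<close>
    also have "\<dots> = (\<Sum>j<Suc m. (if j = k then v $ j else 0)
        + (if j = 0 then if k = i then v $ 0 else 0 else 0))"
      using k by (intro sum.cong) auto
    also have "\<dots> = v $ k + (if k = i then v $ 0 else 0)"
      unfolding sum.distrib using k by (simp add: sum.delta del: sum.lessThan_Suc)
    finally show ?thesis .
  qed
  have "L_lambda m g x (reallocation (Suc m) (id(0 := i)) *\<^sub>v v)
      = (\<Sum>k=1..m. v $ k * g k x + (if k = i then v $ 0 * g k x else 0))"
    unfolding L_lambda_def by (intro sum.cong refl) (simp only: entry, simp add: algebra_simps)
  also have "\<dots> = L_lambda m g x v + v $ 0 * g i x"
    using i by (simp add: sum.distrib L_lambda_def)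
  finally show ?thesis .
qed

theorem theorem2:
  fixes \<Theta> :: "'a set" and m T :: nat
    and g0 :: "'a \<Rightarrow> real" and g gt :: "nat \<Rightarrow> 'a \<Rightarrow> real"
    and \<theta> :: "nat \<Rightarrow> 'a" and l :: "nat \<Rightarrow> real vec"
    and eps_theta eps_lambda :: real
  assumes proxy: "\<And>i x. i \<in> {1..m} \<Longrightarrow> x \<in> \<Theta> \<Longrightarrow> g i x \<le> gt i x"
    and T: "T \<ge> 1"
    and \<theta>_in: "\<And>t. t \<in> {1..T} \<Longrightarrow> \<theta> t \<in> \<Theta>"
    and l_in: "\<And>t. t \<in> {1..T} \<Longrightarrow> l t \<in> prob_simplex (Suc m)"
    and regret_\<theta>:
      "ereal (1 / real T * (\<Sum>t=1..T. L_theta m g0 gt (\<theta> t) (l t)))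
       - (INF x\<in>\<Theta>. ereal (1 / real T * (\<Sum>t=1..T. L_theta m g0 gt x (l t))))
       \<le> ereal eps_theta"
    and regret_l:
      "(SUP M\<in>left_stochastic (Suc m).
          ereal (1 / real T * (\<Sum>t=1..T. L_lambda m g (\<theta> t) (M *\<^sub>v l t))))
       - ereal (1 / real T * (\<Sum>t=1..T. L_lambda m g (\<theta> t) (l t)))
       \<le> ereal eps_lambda"
  shows
    "(mean_vec (Suc m) T l $ 0 > 0 \<longrightarrow>
        ereal (measure_pmf.expectation (theta_bar T \<theta> l) g0)
          \<le> (INF x\<in>{x \<in> \<Theta>. \<forall>i\<in>{1..m}. gt i x \<le> 0}. ereal (g0 x))
            + ereal ((eps_theta + eps_lambda) / (mean_vec (Suc m) T l $ 0))
        \<and> (m \<ge> 1 \<longrightarrow>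
             Max ((\<lambda>i. measure_pmf.expectation (theta_bar T \<theta> l) (g i)) ` {1..m})
               \<le> eps_lambda / (mean_vec (Suc m) T l $ 0)))
     \<and> (\<forall>\<gamma> B :: real.
          (\<exists>x'\<in>\<Theta>. \<forall>i\<in>{1..m}. gt i x' \<le> - \<gamma>)
          \<longrightarrow> ereal B \<ge> (SUP x\<in>\<Theta>. ereal (g0 x)) - (INF x\<in>\<Theta>. ereal (g0 x))
          \<longrightarrow> \<gamma> + B > 0
          \<longrightarrow> mean_vec (Suc m) T l $ 0 \<ge> (\<gamma> - eps_theta - eps_lambda) / (\<gamma> + B))"
proof -
  define S where "S = (\<Sum>t=1..T. l t $ 0)"
  \<comment> \<open>For \<open>S > 0\<close>, \<open>G f / S\<close> is the expectation of
    \<open>f\<close> under \<open>theta_bar\<close>. The undivided form also serves the lower bound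
    on the mean multiplier, where \<open>S > 0\<close> is not assumed.\<close>
  define G where "G f = (\<Sum>t=1..T. l t $ 0 * f (\<theta> t))" for f :: "'a \<Rightarrow> real"
  define A where "A = (\<Sum>t=1..T. L_theta m g0 gt (\<theta> t) (l t))"
  define C where "C = (\<Sum>t=1..T. L_lambda m g (\<theta> t) (l t))"
  have T0: "real T > 0" using T by simp
  have mean: "mean_vec (Suc m) T l $ 0 = S / real T"
    by (simp add: mean_vec_def S_def)
  have carr: "l t \<in> carrier_vec (Suc m)" if "t \<in> {1..T}" for t
    using l_in[OF that] by (simp add: prob_simplex_def)
  have nonneg: "0 \<le> l t $ j" if "t \<in> {1..T}" "j \<le> m" for t j
    using l_in[OF that(1)] that(2) by (simp add: prob_simplex_def)
  have rest: "(\<Sum>i=1..m. l t $ i) = 1 - l t $ 0" if "t \<in> {1..T}" for t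
  proof -
    have "(\<Sum>j<Suc m. l t $ j) = 1"
      using l_in[OF that] by (simp add: prob_simplex_def)
    then show ?thesis
      by (simp add: sum.lessThan_Suc_shift sum.atLeast1_atMost_eq del: sum.lessThan_Suc)
  qed
  have theta_regret: "A \<le> (\<Sum>t=1..T. L_theta m g0 gt x (l t)) + real T * eps_theta"
    if "x \<in> \<Theta>" for x
  proof -
    \<comment> \<open>Replacing the infimum by the value at one point can only decrease the
      difference, which leaves an inequality between reals.\<close>
    have "ereal (1 / real T * A) - ereal (1 / real T * (\<Sum>t=1..T. L_theta m g0 gt x (l t)))
        \<le> ereal eps_theta"
      by (rule order_trans[OF ereal_minus_mono[OF order_refl INF_lower[OF that]]
            regret_\<theta>[folded A_def]])
    then show ?thesis using T0 by (simp add: field_simps)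
  qed
  have lambda_regret: "(\<Sum>t=1..T. L_lambda m g (\<theta> t) (M *\<^sub>v l t)) \<le> C + real T * eps_lambda"
    if "M \<in> left_stochastic (Suc m)" for M
  proof -
    have "ereal (1 / real T * (\<Sum>t=1..T. L_lambda m g (\<theta> t) (M *\<^sub>v l t))) - ereal (1 / real T * C)
        \<le> ereal eps_lambda"
      by (rule order_trans[OF ereal_minus_mono[OF SUP_upper[OF that] order_refl]
            regret_l[folded C_def]])
    then show ?thesis using T0 by (simp add: field_simps)
  qed
  have "0 \<le> C + real T * eps_lambda"
    using lambda_regret[of "reallocation (Suc m) (\<lambda>_. 0)"]
    by (simp add: reallocation_left_stochastic L_lambda_reallocation_to_objective carr)
  \<comment> \<open>In each round the two sides differ only in \<open>g\<close> versus
    \<open>gt\<close> at the iterate, with nonnegative multipliers.\<close>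
  moreover have "G g0 + C \<le> A"
    unfolding G_def C_def A_def sum.distrib[symmetric] L_theta_def L_lambda_def
    by (intro sum_mono add_mono order_refl mult_left_mono proxy \<theta>_in nonneg) auto
  ultimately have G_le: "G g0 \<le> A + real T * eps_lambda" by simp
  have G_constraint: "G (g i) \<le> real T * eps_lambda" if i: "i \<in> {1..m}" for i
  proof -
    have "(\<Sum>t=1..T. L_lambda m g (\<theta> t) (reallocation (Suc m) (id(0 := i)) *\<^sub>v l t)) = C + G (g i)"
      unfolding C_def G_def sum.distrib[symmetric]
      by (intro sum.cong refl L_lambda_reallocation_to_constraint carr i)
    moreover have "reallocation (Suc m) (id(0 := i)) \<in> left_stochastic (Suc m)"
      using i by (intro reallocation_left_stochastic) auto
    ultimately show ?thesis using lambda_regret by fastforce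
  qed
  \<comment> \<open>The constraint multipliers have total mass \<open>1 - l t $ 0\<close> in each
    round, hence \<open>real T - S\<close> overall. Taking \<gamma> = 0 covers feasible
    points.\<close>
  have margin: "(\<Sum>t=1..T. L_theta m g0 gt x (l t)) \<le> S * g0 x - \<gamma> * (real T - S)"
    if "\<forall>i\<in>{1..m}. gt i x \<le> - \<gamma>" for x \<gamma>
  proof -
    have "L_theta m g0 gt x (l t) \<le> l t $ 0 * g0 x - \<gamma> * (1 - l t $ 0)" if t: "t \<in> {1..T}" for t
    proof -
      have "(\<Sum>i=1..m. l t $ i * gt i x) \<le> (\<Sum>i=1..m. l t $ i * - \<gamma>)"
        using t \<open>\<forall>i\<in>{1..m}. gt i x \<le> - \<gamma>\<close>
        by (intro sum_mono mult_left_mono nonneg) auto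
      also have "\<dots> = - \<gamma> * (1 - l t $ 0)"
        unfolding sum_distrib_right[symmetric] rest[OF t] by simp
      finally show ?thesis by (simp add: L_theta_def)
    qed
    then have "(\<Sum>t=1..T. L_theta m g0 gt x (l t)) \<le> (\<Sum>t=1..T. l t $ 0 * g0 x - \<gamma> * (1 - l t $ 0))"
      by (rule sum_mono)
    also have "\<dots> = S * g0 x - \<gamma> * (real T - S)"
      by (simp add: S_def sum_subtractf sum_distrib_right[symmetric] sum_distrib_left[symmetric])
    finally show ?thesis .
  qed
  show ?thesis
  proof (intro conjI impI allI)
    assume pos: "mean_vec (Suc m) T l $ 0 > 0"
    then have S0: "S > 0" using T0 by (simp add: mean zero_less_divide_iff)
    have E: "measure_pmf.expectation (theta_bar T \<theta> l) f = G f / S" for f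
      unfolding G_def S_def by (rule expectation_theta_bar[OF l_in pos])
    {
      \<comment> \<open>With the error term on the left, this is a lower bound for every feasible
        value, so it passes to the infimum, which is \<infinity> if no point is feasible; the error
        is then added back.\<close>
      have "ereal (G g0 / S - (eps_theta + eps_lambda) / (S / real T)) \<le> ereal (g0 x)"
        if "x \<in> {x \<in> \<Theta>. \<forall>i\<in>{1..m}. gt i x \<le> 0}" for x
      proof -
        have "G g0 \<le> S * g0 x + real T * (eps_theta + eps_lambda)"
          using G_le theta_regret[of x] margin[of x 0] that by (simp add: algebra_simps)
        then show ?thesis using S0 T0 by (simp add: field_simps)
      qed
      then have "ereal (G g0 / S - (eps_theta + eps_lambda) / (S / real T))
          \<le> (INF x\<in>{x \<in> \<Theta>. \<forall>i\<in>{1..m}. gt i x \<le> 0}. ereal (g0 x))"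
        by (rule INF_greatest)
      from add_right_mono[OF this, of "ereal ((eps_theta + eps_lambda) / (S / real T))"]
      show "ereal (measure_pmf.expectation (theta_bar T \<theta> l) g0)
          \<le> (INF x\<in>{x \<in> \<Theta>. \<forall>i\<in>{1..m}. gt i x \<le> 0}. ereal (g0 x))
            + ereal ((eps_theta + eps_lambda) / (mean_vec (Suc m) T l $ 0))"
        by (simp add: E mean)
    next
      assume "m \<ge> 1"
      moreover have "G (g i) / S \<le> eps_lambda / (S / real T)" if "i \<in> {1..m}" for i
        using G_constraint[OF that] S0 T0 by (simp add: field_simps)
      ultimately
      show "Max ((\<lambda>i. measure_pmf.expectation (theta_bar T \<theta> l) (g i)) ` {1..m})
          \<le> eps_lambda / (mean_vec (Suc m) T l $ 0)"
        unfolding E mean by (subst Max_le_iff) auto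
    }
  next
    fix \<gamma> B :: real
    assume "\<exists>x'\<in>\<Theta>. \<forall>i\<in>{1..m}. gt i x' \<le> - \<gamma>"
      and B: "ereal B \<ge> (SUP x\<in>\<Theta>. ereal (g0 x)) - (INF x\<in>\<Theta>. ereal (g0 x))"
      and gB: "\<gamma> + B > 0"
    then obtain x where x: "x \<in> \<Theta>" "\<forall>i\<in>{1..m}. gt i x \<le> - \<gamma>" by blast
    have range: "g0 x - B \<le> g0 y" if "y \<in> \<Theta>" for y
    proof -
      have "ereal (g0 x) - ereal (g0 y) \<le> ereal B"
        by (rule order_trans[OF ereal_minus_mono[OF SUP_upper[OF x(1)] INF_lower[OF that]] B])
      then show ?thesis by simp
    qed
    \<comment> \<open>\<open>G g0\<close> is bounded from both sides relative to the same strictly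
      feasible \<open>x\<close>, so \<open>S * g0 x\<close> cancels and only
      \<open>S * (\<gamma> + B)\<close> remains against the margin.\<close>
    have "S * (g0 x - B) \<le> G g0"
      unfolding S_def G_def sum_distrib_right
      by (intro sum_mono mult_left_mono range \<theta>_in nonneg) auto
    also have "\<dots> \<le> S * g0 x - \<gamma> * (real T - S) + real T * eps_theta + real T * eps_lambda"
      using G_le theta_regret[OF x(1)] margin[OF x(2)] by simp
    finally have "real T * (\<gamma> - eps_theta - eps_lambda) \<le> S * (\<gamma> + B)"
      by (simp add: algebra_simps)
    then show "mean_vec (Suc m) T l $ 0 \<ge> (\<gamma> - eps_theta - eps_lambda) / (\<gamma> + B)"
      using T0 gB by (simp add: mean field_simps)
  qed
qed

end
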